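(* Let $m\in\mathbb{N}_0$ and $0<a<b$. Then there exists $\lambda\in(a,b)$ such that $$\left|\beta^{(m)}(b)-\beta^{(m)}(a)\right|\le(b-a)\frac{(m+1)!}{\lambda^{m+2}}.$$
   Context: Nielsen's $\beta$-function is the function $\beta:(0,\infty)\to\mathbb{R}$ defined by $\beta(x)=\int_0^1 \frac{t^{x-1}}{1+t}\,dt=\int_0^\infty\frac{e^{-xt}}{1+e^{-t}}\,dt$ for $x>0$. For $m\in\mathbb{N}_0=\{0,1,2,\dots\}$, $\beta^{(m)}$ denotes its $m$-th derivative, with $\beta^{(0)}=\beta$. *)

theory Defs
  imports "HOL-Analysis.Analysis"
begin

text \<open>
  Nielsen's beta function. It is only meaningful for \<open>x > 0\<close>; for \<open>x \<le> 0\<close> the integrand is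
  not integrable and the value is the default of \<^term>\<open>integral\<close>. The convention
  \<open>0 powr y = 0\<close> affects the integrand only at the endpoint \<open>t = 0\<close>.
\<close>

definition nielsen_beta :: "real \<Rightarrow> real" where
  "nielsen_beta x = integral {0..1} (\<lambda>t. t powr (x - 1) / (1 + t))"

end

theory Submission
  imports Defs
begin

text \<open>
  The mean value theorem turns the claim into the pointwise bound
  \<open>\<bar>\<beta>\<^bsup>(n)\<^esup>(x)\<bar> \<le> n! / x ^ (n + 1)\<close>, used with \<open>n = m + 1\<close> at the intermediate point. Both the
  differentiability of \<open>\<beta>\<close> and this bound come from the closed form
  \<open>\<beta>\<^bsup>(n)\<^esup>(x) = (\<psi>\<^bsup>(n)\<^esup>((x + 1) / 2) - \<psi>\<^bsup>(n)\<^esup>(x / 2)) / 2 ^ (n + 1)\<close>,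
  whose right-hand side is \<open>polygamma_half_diff n x\<close> below; here \<open>\<psi>\<^bsup>(n)\<^esup>\<close> is the polygamma function.

  One observation is used twice. If \<open>f x + f (x + 1) = c\<close> and both summands on the left have the
  same sign as \<open>c\<close>, then \<open>\<bar>f x\<bar> \<le> \<bar>c\<bar>\<close>. For \<open>f = polygamma_half_diff n\<close> the recurrence of the
  polygamma function gives \<open>\<bar>c\<bar> = n! / x ^ (n + 1)\<close>, and the signs agree because \<open>\<psi>\<^bsup>(n)\<^esup>\<close> is
  monotone. This is the bound on the derivatives. For \<open>n = 0\<close> the integral \<open>\<beta>\<close> satisfies the
  same equation with the same right-hand side \<open>1 / x\<close>, because adding the integrands of \<open>\<beta> x\<close>
  and \<open>\<beta> (x + 1)\<close> cancels the denominator \<open>1 + t\<close>. So the difference of the two solutions changes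
  sign under \<open>x \<mapsto> x + 1\<close> and is bounded by \<open>2 / x\<close>; evaluating it at
  \<open>x + k\<close> for \<open>k \<rightarrow> \<infinity>\<close> shows that it vanishes, which is the closed form for \<open>n = 0\<close>. No
  differentiation under the integral sign takes place.
\<close>

definition polygamma_half_diff :: "nat \<Rightarrow> real \<Rightarrow> real" where
  "polygamma_half_diff n x = (Polygamma n ((x + 1) / 2) - Polygamma n (x / 2)) / 2 ^ (n + 1)"

lemma has_field_derivative_polygamma_half_diff:
  assumes "x > 0"
  shows "(polygamma_half_diff n has_field_derivative polygamma_half_diff (Suc n) x) (at x)"
proof -
  have *: "((\<lambda>x. Polygamma n ((x + c) / 2)) has_field_derivative
          Polygamma (Suc n) ((x + c) / 2) * (1 / 2)) (at x)" if "c \<ge> 0" for c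
    using assms that
    by (intro DERIV_chain2[OF has_field_derivative_Polygamma])
       (auto intro!: derivative_eq_intros elim!: nonpos_Ints_cases)
  show ?thesis
    using DERIV_cdivide[OF DERIV_diff[OF *[of 1] *[of 0]], of "2 ^ (n + 1)"]
    by (simp add: polygamma_half_diff_def[abs_def] diff_divide_distrib)
qed

lemma higher_deriv_polygamma_half_diff:
  assumes "x > 0"
  shows "(deriv ^^ n) (polygamma_half_diff 0) x = polygamma_half_diff n x"
  using assms
proof (induction n arbitrary: x)
  case (Suc n)
  have "\<forall>\<^sub>F y in nhds x. (deriv ^^ n) (polygamma_half_diff 0) y = polygamma_half_diff n y"
    using eventually_nhds_in_open[of "{0<..}" x] Suc
    by (auto elim!: eventually_mono)
  then have "(deriv ^^ Suc n) (polygamma_half_diff 0) x = deriv (polygamma_half_diff n) x"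
    by (simp add: deriv_cong_ev)
  also have "\<dots> = polygamma_half_diff (Suc n) x"
    by (intro DERIV_imp_deriv has_field_derivative_polygamma_half_diff Suc.prems)
  finally show ?case .
qed simp

text \<open>
  Two half steps make one full step: up to the factor \<open>1 / 2 ^ (n + 1)\<close>, the sum telescopes to
  \<open>Polygamma n (x / 2 + 1) - Polygamma n (x / 2)\<close>.
\<close>
lemma polygamma_half_diff_plus1:
  assumes "x > 0"
  shows "polygamma_half_diff n x + polygamma_half_diff n (x + 1) = (-1) ^ n * fact n / x ^ (n + 1)"
proof -
  have full_step: "(x + 1 + 1) / 2 = x / 2 + 1"
    by simp
  have "polygamma_half_diff n x + polygamma_half_diff n (x + 1)
      = (Polygamma n (x / 2 + 1) - Polygamma n (x / 2)) / 2 ^ (n + 1)"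
    unfolding polygamma_half_diff_def full_step by (simp add: diff_divide_distrib)
  also have "Polygamma n (x / 2 + 1) - Polygamma n (x / 2) = (-1) ^ n * fact n / (x / 2) ^ Suc n"
    using assms by (subst Polygamma_plus1) auto
  also have "(-1) ^ n * fact n / (x / 2) ^ Suc n / 2 ^ (n + 1) = (-1) ^ n * fact n / x ^ (n + 1)"
    using assms by (simp add: power_divide)
  finally show ?thesis .
qed

lemma polygamma_half_diff_alternating_nonneg:
  assumes "x > 0"
  shows "0 \<le> (-1) ^ n * polygamma_half_diff n x"
proof -
  have "0 \<le> (-1) ^ n * (Polygamma n ((x + 1) / 2) - Polygamma n (x / 2))"
    using assms Polygamma_real_strict_mono[of "x / 2" "(x + 1) / 2" n]
      Polygamma_real_strict_antimono[of "x / 2" "(x + 1) / 2" n]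
    by (cases "even n") auto
  then have "0 \<le> (-1) ^ n * (Polygamma n ((x + 1) / 2) - Polygamma n (x / 2)) / 2 ^ (n + 1)"
    by (rule divide_nonneg_pos) simp
  then show ?thesis
    by (simp only: polygamma_half_diff_def times_divide_eq_right)
qed

lemma abs_polygamma_half_diff_le:
  assumes "x > 0"
  shows "\<bar>polygamma_half_diff n x\<bar> \<le> fact n / x ^ (n + 1)"
proof -
  let ?s = "(-1) ^ n :: real"
  have "?s * polygamma_half_diff n x + ?s * polygamma_half_diff n (x + 1)
      = ?s * (?s * fact n / x ^ (n + 1))"
    by (simp only: polygamma_half_diff_plus1[OF assms, symmetric] distrib_left)
  also have "\<dots> = fact n / x ^ (n + 1)"
    by (cases "even n") simp_all
  finally have "?s * polygamma_half_diff n x \<le> fact n / x ^ (n + 1)"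
    using polygamma_half_diff_alternating_nonneg[of "x + 1" n] assms by simp
  moreover have "\<bar>polygamma_half_diff n x\<bar> = ?s * polygamma_half_diff n x"
    using polygamma_half_diff_alternating_nonneg[OF assms, of n]
    by (cases "even n") simp_all
  ultimately show ?thesis
    by simp
qed

text \<open>For \<open>x < 1\<close> the integrand is unbounded at \<open>0\<close>, where it is dominated by \<open>t powr (x - 1)\<close>.\<close>
lemma nielsen_beta_integrable:
  assumes "x > 0"
  shows "(\<lambda>t::real. t powr (x - 1) / (1 + t)) integrable_on {0..1}"
proof (rule measurable_bounded_by_integrable_imp_integrable)
  show "(\<lambda>t. t powr (x - 1) / (1 + t)) \<in> borel_measurable (lebesgue_on {0..1})"
    by (intro measurable_restrict_space1 measurable_completion) simp
  show "(\<lambda>t. t powr (x - 1)) integrable_on {0..1}"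
    using assms by (intro integrable_on_powr_from_0) auto
  show "norm (t powr (x - 1) / (1 + t)) \<le> t powr (x - 1)" if "t \<in> {0..1}" for t
    using that by (auto simp: divide_simps distrib_left)
qed simp

lemma nielsen_beta_nonneg:
  assumes "x > 0"
  shows "0 \<le> nielsen_beta x"
  unfolding nielsen_beta_def
  by (rule integral_nonneg[OF nielsen_beta_integrable[OF assms]]) auto

lemma nielsen_beta_plus1:
  assumes "x > 0"
  shows "nielsen_beta x + nielsen_beta (x + 1) = 1 / x"
proof -
  have "nielsen_beta x + nielsen_beta (x + 1)
      = integral {0..1} (\<lambda>t. t powr (x - 1) / (1 + t) + t powr (x + 1 - 1) / (1 + t))"
    unfolding nielsen_beta_def using assms
    by (intro integral_add[symmetric] nielsen_beta_integrable) auto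
  also have "\<dots> = integral {0..1} (\<lambda>t. t powr (x - 1))"
  proof (rule integral_cong)
    fix t :: real
    assume "t \<in> {0..1}"
    then have "1 + t \<noteq> 0" and shift: "t powr x = t * t powr (x - 1)"
      by (auto simp: powr_mult_base)
    have "t powr (x - 1) / (1 + t) + t powr (x + 1 - 1) / (1 + t)
        = (1 + t) * t powr (x - 1) / (1 + t)"
      by (simp add: shift distrib_right add_divide_distrib)
    then show "t powr (x - 1) / (1 + t) + t powr (x + 1 - 1) / (1 + t) = t powr (x - 1)"
      using \<open>1 + t \<noteq> 0\<close> by simp
  qed
  also have "\<dots> = 1 / x"
    using has_integral_powr_from_0[of "x - 1" 1] assms by (simp add: integral_unique)
  finally show ?thesis .
qed

lemma abs_nielsen_beta_le:
  assumes "x > 0"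
  shows "\<bar>nielsen_beta x\<bar> \<le> 1 / x"
  using nielsen_beta_plus1[OF assms] nielsen_beta_nonneg[of x] nielsen_beta_nonneg[of "x + 1"] assms
  by simp

text \<open>
  A solution of the homogeneous equation \<open>g (x + 1) = - g x\<close> has constant modulus along
  \<open>x, x + 1, x + 2, \<dots>\<close>, so decay at infinity forces it to be zero.
\<close>
lemma antiperiodic_decaying_eq_0:
  fixes g :: "real \<Rightarrow> real"
  assumes antiperiodic: "\<And>x. x > 0 \<Longrightarrow> g (x + 1) = - g x"
    and decay: "\<And>x. x > 0 \<Longrightarrow> \<bar>g x\<bar> \<le> C / x"
    and "x > 0"
  shows "g x = 0"
proof -
  have modulus: "\<bar>g (x + real k)\<bar> = \<bar>g x\<bar>" for k
  proof (induction k)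
    case (Suc k)
    then show ?case
      using antiperiodic[of "x + real k"] \<open>x > 0\<close> by (simp add: add_ac)
  qed simp
  have "\<bar>g x\<bar> \<le> C / (x + real k)" for k
    using decay[of "x + real k"] modulus[of k] \<open>x > 0\<close> by simp
  moreover have "(\<lambda>k. C / (x + real k)) \<longlonglongrightarrow> 0"
    by (intro tendsto_divide_0[OF tendsto_const] filterlim_at_top_imp_at_infinity
        filterlim_tendsto_add_at_top[OF tendsto_const] filterlim_real_sequentially)
  ultimately have "\<bar>g x\<bar> \<le> 0"
    by (intro LIMSEQ_le_const) auto
  then show ?thesis
    by simp
qed

lemma nielsen_beta_eq_polygamma_half_diff:
  assumes "x > 0"
  shows "nielsen_beta x = polygamma_half_diff 0 x"
proof -
  have "nielsen_beta x - polygamma_half_diff 0 x = 0"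
  proof (rule antiperiodic_decaying_eq_0[where C = 2 and x = x])
    fix y :: real
    assume "y > 0"
    then show "nielsen_beta (y + 1) - polygamma_half_diff 0 (y + 1)
        = - (nielsen_beta y - polygamma_half_diff 0 y)"
      using nielsen_beta_plus1[of y] polygamma_half_diff_plus1[of y 0] by simp
    show "\<bar>nielsen_beta y - polygamma_half_diff 0 y\<bar> \<le> 2 / y"
      using abs_nielsen_beta_le[OF \<open>y > 0\<close>] abs_polygamma_half_diff_le[OF \<open>y > 0\<close>, of 0] by simp
  qed (fact assms)
  then show ?thesis
    by simp
qed

lemma higher_deriv_nielsen_beta:
  assumes "x > 0"
  shows "(deriv ^^ n) nielsen_beta x = polygamma_half_diff n x"
proof -
  have "\<forall>\<^sub>F y in nhds x. nielsen_beta y = polygamma_half_diff 0 y"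
    using eventually_nhds_in_open[of "{0<..}" x] assms
    by (auto elim!: eventually_mono simp: nielsen_beta_eq_polygamma_half_diff)
  then have "(deriv ^^ n) nielsen_beta x = (deriv ^^ n) (polygamma_half_diff 0) x"
    by (rule higher_deriv_cong_ev) simp
  then show ?thesis
    by (simp add: higher_deriv_polygamma_half_diff assms)
qed

theorem theorem2p23:
  fixes m :: nat and a b :: real
  assumes "0 < a" and "a < b"
  shows "\<exists>\<xi>\<in>{a<..<b}.
    \<bar>(deriv ^^ m) nielsen_beta b - (deriv ^^ m) nielsen_beta a\<bar>
      \<le> (b - a) * (fact (m + 1) / \<xi> ^ (m + 2))"
proof -
  obtain \<xi> where \<xi>: "a < \<xi>" "\<xi> < b"
    and mvt: "polygamma_half_diff m b - polygamma_half_diff m a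
      = (b - a) * polygamma_half_diff (Suc m) \<xi>"
    using MVT2[of a b "polygamma_half_diff m" "polygamma_half_diff (Suc m)"] assms
      has_field_derivative_polygamma_half_diff
    by force
  have "\<bar>(deriv ^^ m) nielsen_beta b - (deriv ^^ m) nielsen_beta a\<bar>
      = (b - a) * \<bar>polygamma_half_diff (Suc m) \<xi>\<bar>"
    using assms mvt by (simp add: higher_deriv_nielsen_beta abs_mult)
  also have "\<dots> \<le> (b - a) * (fact (m + 1) / \<xi> ^ (m + 2))"
    using abs_polygamma_half_diff_le[of \<xi> "Suc m"] \<xi> assms by (intro mult_left_mono) auto
  finally show ?thesis
    using \<xi> by auto
qed

end
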